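(* For any integer $n\ge1$ and $m\in(0,1)$, and any pair $(b,y)$ with either $b\in[m,1)$ and $y\ge0$, or $b\in(0,m]$ and $y\le1$, we have $$\log\Bigl(b\frac ym+\bar b\frac{\bar y}{\bar m}\Bigr)\ge f_n(y,b,m),$$ where $$f_n(y,b,m)=\begin{cases}\displaystyle\sum_{k=1}^{2n-1}\frac1k\Bigl(1-\frac{\bar b}{\bar m}\Bigr)^k\Bigl\{\Bigl(1-\frac ym\Bigr)^{2n}-\Bigl(1-\frac ym\Bigr)^k\Bigr\}+\Bigl(1-\frac ym\Bigr)^{2n}\log\frac{\bar b}{\bar m}&\text{if }b\in[m,1),\ y\ge0,\\[2ex]\displaystyle\sum_{k=1}^{2n-1}\frac1k\Bigl(1-\frac bm\Bigr)^k\Bigl\{\Bigl(1-\frac{\bar y}{\bar m}\Bigr)^{2n}-\Bigl(1-\frac{\bar y}{\bar m}\Bigr)^k\Bigr\}+\Bigl(1-\frac{\bar y}{\bar m}\Bigr)^{2n}\log\frac bm&\text{if }b\in(0,m],\ y\le1.\end{cases}$$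
   Context: For a real number $x$, $\bar x=1-x$; $\log$ is the natural logarithm. (For $b=m$ both expressions equal $0$, so the definition is consistent.) *)

theory Defs
  imports Complex_Main
begin

text \<open>
  The two regimes overlap exactly when \<open>b = m\<close> and \<open>0 \<le> y \<le> 1\<close>, where both expressions vanish
  (lemma \<open>f_bound_consistent\<close>). The guard mentions \<open>y\<close> so that \<open>b = m\<close>, \<open>y < 0\<close> falls under the
  second expression. Values outside both regimes are irrelevant.
\<close>

definition f_bound :: "nat \<Rightarrow> real \<Rightarrow> real \<Rightarrow> real \<Rightarrow> real" where
  "f_bound n y b m =
    (if m \<le> b \<and> 0 \<le> y
     then (\<Sum>k = 1..2 * n - 1.
             1 / real k * (1 - (1 - b) / (1 - m)) ^ k *
             ((1 - y / m) ^ (2 * n) - (1 - y / m) ^ k))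
          + (1 - y / m) ^ (2 * n) * ln ((1 - b) / (1 - m))
     else (\<Sum>k = 1..2 * n - 1.
             1 / real k * (1 - b / m) ^ k *
             ((1 - (1 - y) / (1 - m)) ^ (2 * n) - (1 - (1 - y) / (1 - m)) ^ k))
          + (1 - (1 - y) / (1 - m)) ^ (2 * n) * ln (b / m))"

lemma f_bound_upper:
  assumes "m \<le> b" "0 \<le> y"
  shows "f_bound n y b m =
    (\<Sum>k = 1..2 * n - 1.
       1 / real k * (1 - (1 - b) / (1 - m)) ^ k *
       ((1 - y / m) ^ (2 * n) - (1 - y / m) ^ k))
    + (1 - y / m) ^ (2 * n) * ln ((1 - b) / (1 - m))"
  using assms by (simp add: f_bound_def)

lemma f_bound_consistent:
  assumes "0 < m" "m < 1"
  shows "f_bound n y m m = 0"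
  using assms by (auto simp: f_bound_def power_0_left intro!: sum.neutral)

lemma f_bound_lower:
  assumes "0 < m" "m < 1" "b \<le> m"
  shows "f_bound n y b m =
    (\<Sum>k = 1..2 * n - 1.
       1 / real k * (1 - b / m) ^ k *
       ((1 - (1 - y) / (1 - m)) ^ (2 * n) - (1 - (1 - y) / (1 - m)) ^ k))
    + (1 - (1 - y) / (1 - m)) ^ (2 * n) * ln (b / m)"
  using assms by (cases "b = m") (auto simp: f_bound_def power_0_left intro!: sum.cong)

text \<open>The argument of the logarithm is positive, so \<open>ln\<close> is never applied off its domain.\<close>

lemma log_argument_pos:
  fixes m b y :: real
  assumes "0 < m" "m < 1"
    and "(m \<le> b \<and> b < 1 \<and> 0 \<le> y) \<or> (0 < b \<and> b \<le> m \<and> y \<le> 1)"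
  shows "0 < b * (y / m) + (1 - b) * ((1 - y) / (1 - m))"
proof -
  have e1: "b * (y / m) + (1 - b) * ((1 - y) / (1 - m)) =
      y * ((b - m) / (m * (1 - m))) + (1 - b) / (1 - m)"
    using assms(1,2) by (simp add: divide_simps) algebra
  have e2: "b * (y / m) + (1 - b) * ((1 - y) / (1 - m)) =
      (1 - y) * ((m - b) / (m * (1 - m))) + b / m"
    using assms(1,2) by (simp add: divide_simps) algebra
  from assms(3) show ?thesis
  proof
    assume "m \<le> b \<and> b < 1 \<and> 0 \<le> y"
    then show ?thesis unfolding e1 using assms(1,2) by (intro add_nonneg_pos mult_nonneg_nonneg divide_nonneg_pos divide_pos_pos) auto
  next
    assume "0 < b \<and> b \<le> m \<and> y \<le> 1"
    then show ?thesis unfolding e2 using assms(1,2) by (intro add_nonneg_pos mult_nonneg_nonneg divide_nonneg_pos divide_pos_pos) auto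
  qed
qed

end

theory Submission
  imports Defs
begin

text \<open>
  Put \<open>t = 1 - y / m\<close> and \<open>u = 1 - (1 - b) / (1 - m)\<close>. The argument of the logarithm is \<open>1 - t * u\<close>,
  and with the Taylor remainder \<open>R x = ln (1 - x) + (\<Sum>k = 1..2 * n - 1. x ^ k / k)\<close> the claim
  for \<open>b \<ge> m\<close> reads \<open>R (t * u) \<ge> t ^ (2 * n) * R u\<close> for \<open>t \<le> 1\<close> and \<open>0 \<le> u < 1\<close>.
  Since \<open>R' x = - x ^ (2 * n - 1) / (1 - x)\<close>, the difference of the two sides vanishes at \<open>u = 0\<close>
  and has derivative \<open>t ^ (2 * n) * u ^ (2 * n - 1) * (1 / (1 - u) - 1 / (1 - t * u)) \<ge> 0\<close> in \<open>u\<close>.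
  The case \<open>b \<le> m\<close> follows by replacing \<open>b\<close>, \<open>y\<close>, \<open>m\<close> with their complements to \<open>1\<close>.
\<close>

definition ln_remainder :: "nat \<Rightarrow> real \<Rightarrow> real" where
  "ln_remainder N x = ln (1 - x) + (\<Sum>k = 1..N. x ^ k / real k)"

lemma ln_remainder_0 [simp]: "ln_remainder N 0 = 0"
  by (auto simp: ln_remainder_def power_0_left intro!: sum.neutral)

lemma DERIV_ln_remainder:
  assumes "x < 1"
  shows "(ln_remainder N has_real_derivative - (x ^ N) / (1 - x)) (at x)"
proof -
  have "(ln_remainder N has_real_derivative
      - 1 / (1 - x) + (\<Sum>k = 1..N. real k * x ^ (k - 1) / real k)) (at x)"
    unfolding ln_remainder_def [abs_def]
    using assms by (auto intro!: derivative_eq_intros sum.cong)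
  also have "(\<Sum>k = 1..N. real k * x ^ (k - 1) / real k) = (\<Sum>k<N. x ^ k)"
    by (simp add: lessThan_atLeast0 sum.atLeast1_atMost_eq)
  also have "- 1 / (1 - x) + (\<Sum>k<N. x ^ k) = - (x ^ N) / (1 - x)"
    using assms by (simp add: sum_gp_strict divide_simps)
  finally show ?thesis .
qed

lemma ln_remainder_mult_ge:
  assumes "even N" "0 < N" "t \<le> 1" "0 \<le> u" "u < 1"
  shows "t ^ N * ln_remainder (N - 1) u \<le> ln_remainder (N - 1) (t * u)"
proof -
  let ?h = "\<lambda>r. ln_remainder (N - 1) (t * r) - t ^ N * ln_remainder (N - 1) r"
  have "?h 0 \<le> ?h u"
  proof (rule DERIV_nonneg_imp_nondecreasing [OF assms(4)])
    fix r assume r: "0 \<le> r" "r \<le> u"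
    \<comment> \<open>As \<open>r < 1\<close>, this keeps \<open>t * r\<close> below 1, where
      \<open>DERIV_ln_remainder\<close> applies, and fixes the sign of the last factor of the
      derivative.\<close>
    have tr: "t * r \<le> r"
      using mult_right_mono [OF assms(3) r(1)] by simp
    have "(?h has_real_derivative
        - ((t * r) ^ (N - 1)) / (1 - t * r) * t - t ^ N * (- (r ^ (N - 1)) / (1 - r))) (at r)"
      using r tr assms(5)
      by (intro DERIV_diff DERIV_cmult DERIV_ln_remainder DERIV_chain2 [OF DERIV_ln_remainder])
        (auto intro!: derivative_eq_intros)
    moreover have "- ((t * r) ^ (N - 1)) / (1 - t * r) * t - t ^ N * (- (r ^ (N - 1)) / (1 - r))
        = t ^ N * r ^ (N - 1) * (1 / (1 - r) - 1 / (1 - t * r))"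
      by (simp add: power_mult_distrib right_diff_distrib power_minus_mult [OF assms(2), of t, symmetric])
    \<comment> \<open>\<open>t\<close> may be negative: evenness of \<open>N\<close> gives
      \<open>0 \<le> t ^ N\<close>.\<close>
    moreover have "0 \<le> t ^ N * r ^ (N - 1) * (1 / (1 - r) - 1 / (1 - t * r))"
      using r tr assms by (intro mult_nonneg_nonneg) (auto simp: zero_le_even_power intro!: divide_left_mono)
    ultimately show "\<exists>d. (?h has_real_derivative d) (at r) \<and> 0 \<le> d"
      by metis
  qed
  then show ?thesis by simp
qed

lemma ln_one_minus_mult_ge:
  fixes t u :: real
  assumes "n \<ge> 1" "t \<le> 1" "0 \<le> u" "u < 1"
  shows "(\<Sum>k = 1..2 * n - 1. 1 / real k * u ^ k * (t ^ (2 * n) - t ^ k)) + t ^ (2 * n) * ln (1 - u)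
    \<le> ln (1 - t * u)"
proof -
  have "(\<Sum>k = 1..2 * n - 1. 1 / real k * u ^ k * (t ^ (2 * n) - t ^ k))
      = t ^ (2 * n) * (\<Sum>k = 1..2 * n - 1. u ^ k / real k) - (\<Sum>k = 1..2 * n - 1. (t * u) ^ k / real k)"
    unfolding sum_distrib_left sum_subtractf [symmetric]
    by (intro sum.cong) (auto simp: field_simps)
  then show ?thesis
    using ln_remainder_mult_ge [of "2 * n" t u] assms
    by (simp add: ln_remainder_def distrib_left)
qed

lemma ln_mixture_ge:
  fixes m b y :: real
  assumes "n \<ge> 1" "0 < m" "m < 1" "m \<le> b" "b < 1" "0 \<le> y"
  shows "(\<Sum>k = 1..2 * n - 1.
      1 / real k * (1 - (1 - b) / (1 - m)) ^ k * ((1 - y / m) ^ (2 * n) - (1 - y / m) ^ k))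
    + (1 - y / m) ^ (2 * n) * ln ((1 - b) / (1 - m))
    \<le> ln (b * (y / m) + (1 - b) * ((1 - y) / (1 - m)))"
proof -
  have "1 - (1 - y / m) * (1 - (1 - b) / (1 - m)) = b * (y / m) + (1 - b) * ((1 - y) / (1 - m))"
    using assms by (simp add: divide_simps) algebra
  then show ?thesis
    using ln_one_minus_mult_ge [of n "1 - y / m" "1 - (1 - b) / (1 - m)"] assms by simp
qed

theorem lemma16:
  fixes n :: nat and m b y :: real
  assumes "n \<ge> 1"
    and "0 < m" "m < 1"
    and "(m \<le> b \<and> b < 1 \<and> 0 \<le> y) \<or> (0 < b \<and> b \<le> m \<and> y \<le> 1)"
  shows "ln (b * (y / m) + (1 - b) * ((1 - y) / (1 - m))) \<ge> f_bound n y b m"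
  using assms(4)
proof
  assume "m \<le> b \<and> b < 1 \<and> 0 \<le> y"
  then show ?thesis
    using ln_mixture_ge [of n m b y] assms by (simp add: f_bound_upper)
next
  assume "0 < b \<and> b \<le> m \<and> y \<le> 1"
  \<comment> \<open>Complementing swaps the two summands inside the logarithm.
    \<open>f_bound_lower\<close> also covers \<open>b = m\<close>, where the definition may take its
    first branch.\<close>
  then show ?thesis
    using ln_mixture_ge [of n "1 - m" "1 - b" "1 - y"] assms by (simp add: f_bound_lower add.commute)
qed

end
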